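(* For any integers $m\ge 3$, $n\ge 3$ and $p\ge 0$, the binocular graph $\mathrm{BG}(m,n,p)$ satisfies $$\mathrm{BG}(m,n,p)\in \mathrm{FCH}\Bigl(2+\Bigl\lfloor \frac{\min(m,n)}{2}\Bigr\rfloor^{-1}\Bigr).$$
   Context: Graphs are finite and simple. For integers $m,n\ge 3$ and $p\ge 0$, the binocular graph $\mathrm{BG}(m,n,p)$ is the disjoint union of an $m$-cycle $u_0,u_1,\dots,u_{m-1}$ and an $n$-cycle $v_0,\dots,v_{n-1}$, with the vertices $u_0$ and $v_0$ linked by a path of length $p$ given by $u_0,x_1,\dots,x_{p-1},v_0$ (with new internal vertices $x_1,\dots,x_{p-1}$); if $p=0$, then $u_0$ and $v_0$ are the same vertex. Throughout, $a\ge b\ge 1$ are integers. A color-list $L$ of a graph $G$ is an assignment of lists (finite sets) of integers, called colors, to the vertices of $G$; an $a$-color-list is a color-list with $|L(v)|=a$ for every $v\in V(G)$. An $(L,b)$-coloring of $G$ is a mapping $c$ associating to each vertex $u$ a subset $c(u)\subseteq L(u)$ with $|c(u)|=b$ such that $c(u)\cap c(v)=\emptyset$ for every edge $uv\in E(G)$. The graph $G$ is free $(a,b)$-choosable if for every $a$-color-list $L$ of $G$, every vertex $v\in V(G)$ and every set $c_0\subseteq L(v)$ of $b$ colors, there exists an $(L,b)$-coloring $c$ of $G$ such that $c(v)=c_0$. For a real $x$, $\mathrm{FCH}(x)$ is the set of graphs $G$ that are free $(a,b)$-choosable for all integers $a\ge b\ge 1$ with $\frac{a}{b}\ge x$. $\lfloor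 x\rfloor$ is the greatest integer at most $x$. *)

theory Defs
  imports Complex_Main "Graph_Theory.Pair_Digraph"
begin

text \<open>
  A finite simple graph is a \<^locale>\<open>pair_graph\<close>: a finite loop-free digraph whose arcs are
  ordered pairs of vertices and form a symmetric relation. An edge \<open>uv\<close> is the pair of
  arcs \<open>(u, v)\<close> and \<open>(v, u)\<close>.
\<close>

datatype bg_vertex = U nat | X nat | V nat

text \<open>
  \<open>bg_v p j\<close> is the vertex \<open>v\<^sub>j\<close>; for \<open>p = 0\<close> the vertex \<open>v\<^sub>0\<close> is \<open>u\<^sub>0\<close>.
  \<open>bg_path p i\<close> is the vertex at position \<open>i \<le> p\<close> of the path from \<open>u\<^sub>0\<close> to \<open>v\<^sub>0\<close>.
\<close>

definition bg_v :: "nat \<Rightarrow> nat \<Rightarrow> bg_vertex" where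
  "bg_v p j = (if p = 0 \<and> j = 0 then U 0 else V j)"

definition bg_path :: "nat \<Rightarrow> nat \<Rightarrow> bg_vertex" where
  "bg_path p i = (if i = 0 then U 0 else if i < p then X i else bg_v p 0)"

definition bg_links :: "nat \<Rightarrow> nat \<Rightarrow> nat \<Rightarrow> (bg_vertex \<times> bg_vertex) set" where
  "bg_links m n p =
     {(U i, U (Suc i mod m)) | i. i < m} \<union>
     {(bg_v p j, bg_v p (Suc j mod n)) | j. j < n} \<union>
     {(bg_path p i, bg_path p (Suc i)) | i. i < p}"

definition BG :: "nat \<Rightarrow> nat \<Rightarrow> nat \<Rightarrow> bg_vertex pair_pre_digraph" where
  "BG m n p =
     \<lparr> pverts = U ` {..<m} \<union> bg_v p ` {..<n} \<union> X ` {1..<p},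
       parcs = bg_links m n p \<union> (bg_links m n p)\<inverse> \<rparr>"

definition color_list :: "'v pair_pre_digraph \<Rightarrow> ('v \<Rightarrow> int set) \<Rightarrow> bool" where
  "color_list G L \<longleftrightarrow> (\<forall>v\<in>pverts G. finite (L v))"

definition a_color_list :: "nat \<Rightarrow> 'v pair_pre_digraph \<Rightarrow> ('v \<Rightarrow> int set) \<Rightarrow> bool" where
  "a_color_list a G L \<longleftrightarrow> color_list G L \<and> (\<forall>v\<in>pverts G. card (L v) = a)"

definition Lb_coloring ::
    "'v pair_pre_digraph \<Rightarrow> ('v \<Rightarrow> int set) \<Rightarrow> nat \<Rightarrow> ('v \<Rightarrow> int set) \<Rightarrow> bool" where
  "Lb_coloring G L b c \<longleftrightarrow>
     (\<forall>u\<in>pverts G. c u \<subseteq> L u \<and> card (c u) = b) \<and>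
     (\<forall>(u, v)\<in>parcs G. c u \<inter> c v = {})"

definition free_choosable :: "nat \<Rightarrow> nat \<Rightarrow> 'v pair_pre_digraph \<Rightarrow> bool" where
  "free_choosable a b G \<longleftrightarrow>
     (\<forall>L v c0. a_color_list a G L \<and> v \<in> pverts G \<and> c0 \<subseteq> L v \<and> card c0 = b \<longrightarrow>
        (\<exists>c. Lb_coloring G L b c \<and> c v = c0))"

definition FCH :: "real \<Rightarrow> 'v pair_pre_digraph set" where
  "FCH x = {G. pair_graph G \<and>
     (\<forall>a b. a \<ge> b \<and> b \<ge> 1 \<and> real a / real b \<ge> x \<longrightarrow> free_choosable a b G)}"

end

theory Submission
  imports Defs
begin

text \<open>
  Since \<open>a \<ge> 2 b\<close>, colorings extend greedily along the path, so it suffices to color a cycle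
  \<open>0, \<dots>, n - 1\<close> when one of its vertices, say \<open>0\<close>, is precolored. Let \<open>a = 2 b + e\<close>. Walking
  along the cycle from \<open>0\<close>, one keeps control of how few colors of a prescribed set \<open>T\<close> have to be
  used: if \<open>T'\<close> is a subset of the next list that avoids \<open>T\<close>, then a color set meeting \<open>T'\<close> in few
  elements leaves many colors of \<open>T'\<close> to the next vertex, which then needs few colors of \<open>T\<close>.
  With \<open>card T\<close> alternating between \<open>b\<close> and \<open>b + e\<close> every two steps gain \<open>e\<close>, and the \<open>n div 2\<close>
  gains available before the cycle closes amount to at least \<open>b\<close>.
\<close>

section \<open>Colorings of paths and cycles, with vertices represented by positions\<close>

definition path_coloring ::
    "(nat \<Rightarrow> 'c set) \<Rightarrow> nat \<Rightarrow> nat \<Rightarrow> (nat \<Rightarrow> 'c set) \<Rightarrow> bool" where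
  "path_coloring L b k c \<longleftrightarrow>
     (\<forall>i\<le>k. c i \<subseteq> L i \<and> card (c i) = b) \<and> (\<forall>i<k. c i \<inter> c (Suc i) = {})"

text \<open>Indexing by positions lets one result serve both cycles of \<open>BG m n p\<close>, read
  through \<open>U\<close> and through \<open>bg_v p\<close>. Here \<open>n\<close> counts vertices,
  whereas the \<open>k\<close> of \<open>path_coloring\<close> counts edges.\<close>

definition cycle_coloring ::
    "(nat \<Rightarrow> 'c set) \<Rightarrow> nat \<Rightarrow> nat \<Rightarrow> (nat \<Rightarrow> 'c set) \<Rightarrow> bool" where
  "cycle_coloring L b n c \<longleftrightarrow>
     (\<forall>i<n. c i \<subseteq> L i \<and> card (c i) = b \<and> c i \<inter> c (Suc i mod n) = {})"

lemma path_coloring_extend: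
  assumes "path_coloring L b k c" "d \<subseteq> L (Suc k)" "card d = b" "c k \<inter> d = {}"
  shows "path_coloring L b (Suc k) (c(Suc k := d))"
  using assms unfolding path_coloring_def by (auto simp: le_Suc_eq less_Suc_eq)

lemma obtain_subset_avoiding:
  assumes "finite D" "b + card D \<le> card A"
  obtains d where "d \<subseteq> A - D" "card d = b"
proof -
  have "card A - card D \<le> card (A - D)"
    using assms(1) by (rule diff_card_le_card_Diff)
  then have "b \<le> card (A - D)"
    using assms(2) by linarith
  then show thesis
    using that by (metis obtain_subset_with_card_n)
qed

text \<open>Greedy choice: one neighbor forbids at most \<open>b\<close> of at least
  \<open>2 * b\<close> colors. When the prescribed vertex is the last one, its predecessor is first
  given a set avoiding \<open>c0\<close>, which becomes the prescription for the shorter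
  path.\<close>

lemma path_free_choosable:
  assumes "\<forall>i\<le>k. finite (L i) \<and> 2 * b \<le> card (L i)"
    and "r \<le> k" "c0 \<subseteq> L r" "card c0 = b"
  shows "\<exists>c. path_coloring L b k c \<and> c r = c0"
  using assms
proof (induction k arbitrary: r c0)
  case 0
  then show ?case
    by (intro exI[of _ "\<lambda>_. c0"]) (auto simp: path_coloring_def)
next
  case (Suc k)
  show ?case
  proof (cases "r \<le> k")
    case True
    then obtain c where c: "path_coloring L b k c" "c r = c0"
      using Suc.IH[of r c0] Suc.prems by auto
    have ck: "card (c k) = b" "c k \<subseteq> L k"
      using c(1) by (auto simp: path_coloring_def)
    have "finite (c k)"
      using ck(2) Suc.prems(1) by (meson finite_subset le_SucI order_refl)
    moreover have "b + card (c k) \<le> card (L (Suc k))"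
      using ck(1) Suc.prems(1) by (metis mult_2 order_refl)
    ultimately obtain d where "d \<subseteq> L (Suc k) - c k" "card d = b"
      by (rule obtain_subset_avoiding)
    then have "path_coloring L b (Suc k) (c(Suc k := d))"
      by (intro path_coloring_extend c(1)) auto
    moreover have "(c(Suc k := d)) r = c0"
      using c(2) True by simp
    ultimately show ?thesis
      by blast
  next
    case False
    then have r: "r = Suc k"
      using Suc.prems by simp
    have "finite c0"
      using Suc.prems r by (meson finite_subset order_refl)
    moreover have "b + card c0 \<le> card (L k)"
      using Suc.prems(1,4) by (metis mult_2 le_SucI order_refl)
    ultimately obtain d where d: "d \<subseteq> L k - c0" "card d = b"
      by (rule obtain_subset_avoiding)
    have "\<exists>c. path_coloring L b k c \<and> c k = d"
      using Suc.prems(1) d by (intro Suc.IH) auto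
    then obtain c where c: "path_coloring L b k c" "c k = d"
      by blast
    have "path_coloring L b (Suc k) (c(Suc k := c0))"
      using Suc.prems r c d by (intro path_coloring_extend) auto
    moreover have "(c(Suc k := c0)) r = c0"
      using r by simp
    ultimately show ?thesis
      by blast
  qed
qed

lemma obtain_coloring_step:
  assumes fin: "finite A" "finite C" "finite T'"
    and cA: "b + card C \<le> card A"
    and T': "T' \<subseteq> A - T" "b \<le> card T' + t - card (C \<inter> T')"
  obtains d where "d \<subseteq> A - C" "card d = b" "card (d \<inter> T) \<le> t"
proof (cases "b \<le> card (T' - C)")
  case True
  then obtain d where d: "d \<subseteq> T' - C" "card d = b"
    by (metis obtain_subset_with_card_n)
  then have "d \<inter> T = {}"
    using T'(1) by blast
  then show thesis
    using that[of d] d T'(1) by auto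
next
  case False
  let ?S = "T' - C"
  have "card A - card C \<le> card (A - C)"
    using fin(2) by (rule diff_card_le_card_Diff)
  then have "b \<le> card (A - C)"
    using cA by linarith
  moreover have "?S \<subseteq> A - C"
    using T'(1) by blast
  \<comment> \<open>All of \<open>?S\<close> is used up, so \<open>d \<inter> T\<close> is contained
    in \<open>d - ?S\<close>.\<close>
  ultimately obtain d where d: "?S \<subseteq> d" "d \<subseteq> A - C" "card d = b"
    using False fin(1) exists_subset_between[of ?S b "A - C"] by auto
  have "card ?S = card T' - card (C \<inter> T')"
    using fin(3) by (simp add: card_Diff_subset_Int Int_commute)
  moreover have "card (C \<inter> T') \<le> card T'"
    using fin(3) by (intro card_mono) auto
  ultimately have "b \<le> card ?S + t"
    using T'(2) by linarith
  moreover have "finite d"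
    using d(2) fin(1) by (meson finite_Diff finite_subset)
  then have "card (d - ?S) = b - card ?S"
    using d(1,3) by (metis card_Diff_subset finite_subset)
  moreover have "card (d \<inter> T) \<le> card (d - ?S)"
    using \<open>finite d\<close> T'(1) by (intro card_mono) auto
  ultimately show thesis
    using that[of d] d by linarith
qed

text \<open>The set \<open>T'\<close> to be controlled at \<open>k\<close> is picked inside
  \<open>L (Suc k) - T\<close>, which has room for \<open>q\<close> colors. It depends on the next
  list, so the hypothesis has to cover every set of size at most \<open>q\<close>.\<close>

lemma path_coloring_avoiding_step:
  assumes IH: "\<And>T. finite T \<Longrightarrow> card T \<le> q \<Longrightarrow>
      \<exists>c. path_coloring L b k c \<and> c 0 = c0 \<and> card (c k \<inter> T) \<le> t"
    and L: "finite (L k)" "finite (L (Suc k))" "card (L (Suc k)) = a" "2 * b \<le> a"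
    and T: "finite T" "card T + q \<le> a"
    and q: "b + t \<le> q + t'"
  shows "\<exists>c. path_coloring L b (Suc k) c \<and> c 0 = c0 \<and> card (c (Suc k) \<inter> T) \<le> t'"
proof -
  have "q + card T \<le> card (L (Suc k))"
    using L T by linarith
  then obtain T' where T': "T' \<subseteq> L (Suc k) - T" "card T' = q"
    using T(1) by (metis obtain_subset_avoiding)
  have finT': "finite T'"
    using T'(1) L(2) by (meson finite_Diff finite_subset)
  then obtain c where c: "path_coloring L b k c" "c 0 = c0" "card (c k \<inter> T') \<le> t"
    using IH T'(2) by blast
  have ck: "c k \<subseteq> L k" "card (c k) = b"
    using c(1) by (auto simp: path_coloring_def)
  obtain d where d: "d \<subseteq> L (Suc k) - c k" "card d = b" "card (d \<inter> T) \<le> t'"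
  proof (rule obtain_coloring_step)
    show "finite (L (Suc k))" "finite (c k)" "finite T'"
      using L ck finT' by (auto intro: finite_subset)
    show "b + card (c k) \<le> card (L (Suc k))"
      using L ck by simp
    show "T' \<subseteq> L (Suc k) - T"
      by (fact T')
    show "b \<le> card T' + t' - card (c k \<inter> T')"
      using T' c(3) q by linarith
  qed
  have "path_coloring L b (Suc k) (c(Suc k := d))"
    using c d by (intro path_coloring_extend) auto
  then show ?thesis
    using c d by (intro exI[of _ "c(Suc k := d)"]) auto
qed

text \<open>The two claims need each other in the induction. For \<open>card T \<le> b\<close> the
  step takes \<open>q = b + e\<close> and gains \<open>e\<close>; for
  \<open>card T \<le> b + e\<close> only \<open>q = b\<close> fits and the bound is passed on
  unchanged.\<close>

lemma path_coloring_avoiding: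
  assumes L: "\<forall>i\<le>k. finite (L i) \<and> card (L i) = 2 * b + e"
    and c0: "finite c0" "c0 \<subseteq> L 0" "card c0 = b"
  shows "finite T \<Longrightarrow> card T \<le> b \<Longrightarrow>
           \<exists>c. path_coloring L b k c \<and> c 0 = c0 \<and> card (c k \<inter> T) \<le> b - (Suc k div 2) * e"
    and "finite T \<Longrightarrow> card T \<le> b + e \<Longrightarrow>
           \<exists>c. path_coloring L b k c \<and> c 0 = c0 \<and> card (c k \<inter> T) \<le> b - (k div 2) * e"
  using L
proof (induction k arbitrary: T)
  case 0
  have "card (c0 \<inter> T) \<le> b" for T
    using c0 by (metis card_mono inf_le1)
  then have "path_coloring L b 0 (\<lambda>_. c0) \<and> card (c0 \<inter> T) \<le> b" for T
    using c0 by (simp add: path_coloring_def)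
  then show "\<exists>c. path_coloring L b 0 c \<and> c 0 = c0 \<and> card (c 0 \<inter> T) \<le> b - Suc 0 div 2 * e"
    and "\<exists>c. path_coloring L b 0 c \<and> c 0 = c0 \<and> card (c 0 \<inter> T) \<le> b - 0 div 2 * e" for T
    by (auto intro!: exI[of _ "\<lambda>_. c0"])
next
  case (Suc k)
  have L': "finite (L k)" "finite (L (Suc k))" "card (L (Suc k)) = 2 * b + e"
    "2 * b \<le> 2 * b + e" if "\<forall>i\<le>Suc k. finite (L i) \<and> card (L i) = 2 * b + e"
    using that by auto
  { case 1
    show ?case
      by (rule path_coloring_avoiding_step[OF Suc.IH(2) L'[OF 1(3)]]) (use 1 in auto)
  next
    case 2
    show ?case
      by (rule path_coloring_avoiding_step[OF Suc.IH(1) L'[OF 2(3)]]) (use 2 in auto)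
  }
qed

section \<open>Closing a path to a cycle\<close>

lemma cycle_coloring_if_path_coloring:
  assumes "path_coloring L b k c" "c k \<inter> c 0 = {}"
  shows "cycle_coloring L b (Suc k) c"
  unfolding cycle_coloring_def
proof (intro allI impI)
  fix i
  assume "i < Suc k"
  then show "c i \<subseteq> L i \<and> card (c i) = b \<and> c i \<inter> c (Suc i mod Suc k) = {}"
    using assms by (cases "i = k") (auto simp: path_coloring_def simp del: mod_Suc_eq)
qed

lemma cycle_free_choosable_at_0:
  assumes L: "\<forall>i<n. finite (L i) \<and> card (L i) = 2 * b + e"
    and n: "2 \<le> n" "b \<le> (n div 2) * e"
    and c0: "c0 \<subseteq> L 0" "card c0 = b"
  shows "\<exists>c. cycle_coloring L b n c \<and> c 0 = c0"
proof -
  obtain k where k: "n = Suc (Suc k)"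
    using n(1) by (metis add_2_eq_Suc le_Suc_ex)
  have fin0: "finite c0"
    using L k c0 by (auto intro: finite_subset)
  \<comment> \<open>The last vertex \<open>Suc k\<close> is adjacent to both \<open>k\<close> and
    \<open>0\<close>. Restricting it to a set \<open>T\<close> disjoint from \<open>c0\<close>
    settles the closing edge in advance.\<close>
  have "b + e + card c0 \<le> card (L (Suc k))"
    using L k c0 by simp
  then obtain T where T: "T \<subseteq> L (Suc k) - c0" "card T = b + e"
    using fin0 by (metis obtain_subset_avoiding)
  have finT: "finite T"
    using T L k by (metis finite_Diff finite_subset lessI)
  obtain c where c: "path_coloring L b k c" "c 0 = c0" "card (c k \<inter> T) \<le> b - (k div 2) * e"
    using path_coloring_avoiding(2)[of k L b e c0 T] L k c0 fin0 T finT by auto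
  \<comment> \<open>As \<open>n = k + 2\<close>, \<open>n div 2\<close> exceeds
    \<open>k div 2\<close> by one. Hence \<open>c k\<close> takes at most \<open>e\<close> of the
    \<open>b + e\<close> colors in \<open>T\<close>.\<close>
  have "b - (k div 2) * e \<le> e"
    using n(2) k by simp
  then have "b + card (c k \<inter> T) \<le> card T"
    using T(2) c(3) by linarith
  then obtain d where d: "d \<subseteq> T - (c k \<inter> T)" "card d = b"
    using finT by (metis finite_Int obtain_subset_avoiding)
  have "path_coloring L b (Suc k) (c(Suc k := d))"
    using c d T by (intro path_coloring_extend) auto
  moreover have "d \<inter> c0 = {}"
    using d T by blast
  ultimately have "cycle_coloring L b n (c(Suc k := d))"
    unfolding k using c(2) by (intro cycle_coloring_if_path_coloring) auto
  then show ?thesis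
    using c(2) by (intro exI[of _ "c(Suc k := d)"]) auto
qed

text \<open>By rotation, the prescribed vertex may be moved to position \<open>0\<close>. The map
  \<open>?rot\<close> undoes the shift by \<open>r\<close>; adding \<open>n - r\<close> avoids
  truncated subtraction.\<close>

lemma cycle_free_choosable:
  assumes L: "\<forall>i<n. finite (L i) \<and> card (L i) = 2 * b + e"
    and n: "2 \<le> n" "b \<le> (n div 2) * e"
    and c0: "r < n" "c0 \<subseteq> L r" "card c0 = b"
  shows "\<exists>c. cycle_coloring L b n c \<and> c r = c0"
proof -
  let ?rot = "\<lambda>i. (i + (n - r)) mod n"
  obtain c where c: "cycle_coloring (\<lambda>i. L ((i + r) mod n)) b n c" "c 0 = c0"
    using cycle_free_choosable_at_0[of n "\<lambda>i. L ((i + r) mod n)" b e c0] assms by auto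
  have "(?rot i + r) mod n = i" if "i < n" for i
    using that c0(1) by (simp add: mod_add_left_eq)
  moreover have "?rot (Suc i mod n) = Suc (?rot i) mod n" for i
    by (simp add: mod_add_left_eq mod_Suc_eq)
  moreover have "?rot i < n" for i
    using n by simp
  ultimately have "cycle_coloring L b n (\<lambda>i. c (?rot i))"
    using c(1) unfolding cycle_coloring_def by metis
  moreover have "c (?rot r) = c0"
    using c(2) c0(1) by simp
  ultimately show ?thesis
    by blast
qed

section \<open>The binocular graph and its three pieces\<close>

lemma bg_v_eq_iff: "bg_v p i = bg_v p j \<longleftrightarrow> i = j"
  by (auto simp: bg_v_def)

text \<open>Every vertex is located on a piece by its position there. The cases overlap at the ends
  of the path, and each \<open>X i\<close> falls under \<open>P\<close>.\<close>

lemma BG_vertex_cases: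
  assumes "w \<in> pverts (BG m n p)"
  obtains (U) i where "i < m" "w = U i" | (V) j where "j < n" "w = bg_v p j"
    | (P) i where "i \<le> p" "w = bg_path p i"
proof -
  have thesis if "w = X i" "1 \<le> i" "i < p" for i
    using that P[of i] by (simp add: bg_path_def)
  then show thesis
    using assms U V by (auto simp: BG_def)
qed

lemma pair_graph_BG:
  assumes "2 \<le> m" "2 \<le> n"
  shows "pair_graph (BG m n p)"
proof -
  let ?W = "U ` {..<m} \<union> bg_v p ` {..<n} \<union> X ` {1..<p}"
  have path: "bg_path p i \<in> ?W" for i
    using assms by (auto simp: bg_path_def)
  have verts: "bg_links m n p \<subseteq> ?W \<times> ?W"
    using assms path unfolding bg_links_def by auto
  have neq: "Suc i mod k \<noteq> i" if "2 \<le> k" "i < k" for i k :: nat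
    using that by (cases "Suc i = k") auto
  \<comment> \<open>From \<open>i < p\<close> follows \<open>p > 0\<close>, so that
    \<open>v_0\<close> is \<open>V 0\<close> and differs from \<open>U 0\<close>.\<close>
  have path_neq: "bg_path p (Suc i) \<noteq> bg_path p i" if "i < p" for i
    using that by (auto simp: bg_path_def bg_v_def)
  have loops: "(v, v) \<notin> bg_links m n p" for v
    using assms
    by (auto simp: bg_links_def bg_v_eq_iff neq neq[THEN not_sym] path_neq path_neq[THEN not_sym])
  have "finite (?W \<times> ?W)"
    by simp
  then have fin: "finite (bg_links m n p)"
    using verts finite_subset by blast
  show ?thesis
  proof
    show "finite (pverts (BG m n p))" "finite (parcs (BG m n p))"
      using fin by (auto simp: BG_def)
    show "fst e \<in> pverts (BG m n p)" "snd e \<in> pverts (BG m n p)" "fst e \<noteq> snd e"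
      if "e \<in> parcs (BG m n p)" for e
      using that verts loops by (cases e; auto simp: BG_def)+
    show "symmetric (with_proj (BG m n p))"
      unfolding symmetric_def by (auto simp: BG_def sym_def arcs_ends_def arc_to_ends_def)
  qed
qed

text \<open>Colorings of the three pieces glue once they agree at \<open>u_0\<close> and
  \<open>v_0\<close>. The values along each piece are part of the conclusion so that a prescribed
  color set can be traced.\<close>

lemma Lb_coloring_BG:
  assumes cu: "cycle_coloring (\<lambda>i. L (U i)) b m cu"
    and cx: "path_coloring (\<lambda>i. L (bg_path p i)) b p cx"
    and cv: "cycle_coloring (\<lambda>j. L (bg_v p j)) b n cv"
    and ends: "cx 0 = cu 0" "cx p = cv 0"
  shows "\<exists>c. Lb_coloring (BG m n p) L b c \<and> (\<forall>i. c (U i) = cu i) \<and>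
           (\<forall>j. c (bg_v p j) = cv j) \<and> (\<forall>i\<le>p. c (bg_path p i) = cx i)"
proof -
  define c where "c w = (case w of U i \<Rightarrow> cu i | X i \<Rightarrow> cx i | V j \<Rightarrow> cv j)" for w
  have cU: "c (U i) = cu i" for i
    by (simp add: c_def)
  \<comment> \<open>For \<open>p = 0\<close> and \<open>j = 0\<close> this vertex is
    \<open>U 0\<close>, and \<open>ends\<close> gives \<open>cu 0 = cx 0 = cv 0\<close>.\<close>
  have cV: "c (bg_v p j) = cv j" for j
    using ends by (auto simp: c_def bg_v_def)
  have cP: "c (bg_path p i) = cx i" if "i \<le> p" for i
    using that ends cV[of 0] by (auto simp: bg_path_def c_def)
  have verts: "c w \<subseteq> L w \<and> card (c w) = b" if "w \<in> pverts (BG m n p)" for w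
    using that
    by (cases rule: BG_vertex_cases)
      (use cu cx cv in \<open>auto simp: cU cV cP cycle_coloring_def path_coloring_def\<close>)
  have disj: "i < m \<Longrightarrow> cu i \<inter> cu (Suc i mod m) = {}" "i < n \<Longrightarrow> cv i \<inter> cv (Suc i mod n) = {}"
    "i < p \<Longrightarrow> cx i \<inter> cx (Suc i) = {}" for i
    using cu cx cv by (auto simp: cycle_coloring_def path_coloring_def)
  have "c w \<inter> c z = {}" if "(w, z) \<in> bg_links m n p" for w z
    using that unfolding bg_links_def by (elim UnE CollectE exE conjE) (simp_all add: cU cV cP disj)
  then have "c w \<inter> c z = {}" if "(w, z) \<in> parcs (BG m n p)" for w z
    using that by (auto simp: BG_def Int_commute)
  then have "Lb_coloring (BG m n p) L b c"
    unfolding Lb_coloring_def using verts by blast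
  then show ?thesis
    using cU cV cP by blast
qed

text \<open>The piece containing the prescribed vertex is colored first. The others follow outwards,
  each with its shared vertex prescribed by the piece already colored.\<close>

lemma free_choosable_BG:
  assumes m: "2 \<le> m" "b \<le> (m div 2) * e" and n: "2 \<le> n" "b \<le> (n div 2) * e"
  shows "free_choosable (2 * b + e) b (BG m n p)"
  unfolding free_choosable_def
proof (intro allI impI, elim conjE)
  fix L w c0
  assume L: "a_color_list (2 * b + e) (BG m n p) L"
    and w: "w \<in> pverts (BG m n p)" and c0: "c0 \<subseteq> L w" "card c0 = b"
  have verts: "U i \<in> pverts (BG m n p)" if "i < m" for i
    using that by (simp add: BG_def)
  have verts': "bg_v p j \<in> pverts (BG m n p)" if "j < n" for j
    using that by (simp add: BG_def)
  have verts'': "bg_path p i \<in> pverts (BG m n p)" for i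
    using m n by (auto simp: BG_def bg_path_def)
  note LD = L[unfolded a_color_list_def color_list_def]
  have cyc_u: "\<exists>c. cycle_coloring (\<lambda>i. L (U i)) b m c \<and> c r = d"
    if "r < m" "d \<subseteq> L (U r)" "card d = b" for r d
    using cycle_free_choosable[of m "\<lambda>i. L (U i)" b e r d] LD verts m that by auto
  have cyc_v: "\<exists>c. cycle_coloring (\<lambda>j. L (bg_v p j)) b n c \<and> c r = d"
    if "r < n" "d \<subseteq> L (bg_v p r)" "card d = b" for r d
    using cycle_free_choosable[of n "\<lambda>j. L (bg_v p j)" b e r d] LD verts' n that by auto
  have path: "\<exists>c. path_coloring (\<lambda>i. L (bg_path p i)) b p c \<and> c r = d"
    if "r \<le> p" "d \<subseteq> L (bg_path p r)" "card d = b" for r d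
    using path_free_choosable[of p "\<lambda>i. L (bg_path p i)" b r d] LD verts'' that by auto
  have p0: "bg_path p 0 = U 0" and pp: "bg_path p p = bg_v p 0"
    by (auto simp: bg_path_def bg_v_def)
  have cyc0: "c 0 \<subseteq> M 0" "card (c 0) = b" if "cycle_coloring M b k c" "2 \<le> k"
    for c M :: "nat \<Rightarrow> int set" and k
    using that by (auto simp: cycle_coloring_def)
  have pathD: "c i \<subseteq> L (bg_path p i)" "card (c i) = b"
    if "path_coloring (\<lambda>i. L (bg_path p i)) b p c" "i \<le> p" for c i
    using that by (auto simp: path_coloring_def)
  from w show "\<exists>c. Lb_coloring (BG m n p) L b c \<and> c w = c0"
  proof (cases rule: BG_vertex_cases)
    case (U r)
    obtain cu where cu: "cycle_coloring (\<lambda>i. L (U i)) b m cu" "cu r = c0"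
      using cyc_u U c0 by blast
    obtain cx where cx: "path_coloring (\<lambda>i. L (bg_path p i)) b p cx" "cx 0 = cu 0"
      using path[of 0 "cu 0"] cyc0[OF cu(1) m(1)] p0 by auto
    obtain cv where cv: "cycle_coloring (\<lambda>j. L (bg_v p j)) b n cv" "cv 0 = cx p"
      using cyc_v[of 0 "cx p"] pathD[OF cx(1), of p] pp n by auto
    show ?thesis
      using Lb_coloring_BG[OF cu(1) cx(1) cv(1) cx(2) cv(2)[symmetric]] U cu(2) by auto
  next
    case (V r)
    obtain cv where cv: "cycle_coloring (\<lambda>j. L (bg_v p j)) b n cv" "cv r = c0"
      using cyc_v V c0 by blast
    obtain cx where cx: "path_coloring (\<lambda>i. L (bg_path p i)) b p cx" "cx p = cv 0"
      using path[of p "cv 0"] cyc0[OF cv(1) n(1)] pp by auto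
    obtain cu where cu: "cycle_coloring (\<lambda>i. L (U i)) b m cu" "cu 0 = cx 0"
      using cyc_u[of 0 "cx 0"] pathD[OF cx(1), of 0] p0 m by auto
    show ?thesis
      using Lb_coloring_BG[OF cu(1) cx(1) cv(1) cu(2)[symmetric] cx(2)] V cv(2) by auto
  next
    \<comment> \<open>Both cycles are attached to the colored path independently, one at each
      end.\<close>
    case (P r)
    obtain cx where cx: "path_coloring (\<lambda>i. L (bg_path p i)) b p cx" "cx r = c0"
      using path P c0 by blast
    obtain cu where cu: "cycle_coloring (\<lambda>i. L (U i)) b m cu" "cu 0 = cx 0"
      using cyc_u[of 0 "cx 0"] pathD[OF cx(1), of 0] p0 m by auto
    obtain cv where cv: "cycle_coloring (\<lambda>j. L (bg_v p j)) b n cv" "cv 0 = cx p"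
      using cyc_v[of 0 "cx p"] pathD[OF cx(1), of p] pp n by auto
    show ?thesis
      using Lb_coloring_BG[OF cu(1) cx(1) cv(1) cu(2)[symmetric] cv(2)[symmetric]] P cx(2)
      by auto
  qed
qed

theorem proposition9:
  fixes m n p :: nat
  assumes "m \<ge> 3" and "n \<ge> 3"
  shows "BG m n p \<in> FCH (2 + inverse (real_of_int \<lfloor>real (min m n) / 2\<rfloor>))"
proof -
  define s where "s = min m n div 2"
  have s: "1 \<le> s" "s \<le> m div 2" "s \<le> n div 2"
    using assms by (auto simp: s_def min_def)
  have floor: "\<lfloor>real (min m n) / 2\<rfloor> = int s"
    using floor_divide_of_nat_eq[of "min m n" 2] by (simp add: s_def)
  have "free_choosable a b (BG m n p)"
    if b: "1 \<le> b" and ab: "2 + inverse (real s) \<le> real a / real b" for a b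
  proof -
    \<comment> \<open>Multiplying by \<open>s * b\<close> clears both denominators and moves the
      inequality to the natural numbers.\<close>
    have "(2 + inverse (real s)) * (real s * real b) \<le> (real a / real b) * (real s * real b)"
      using ab by (intro mult_right_mono) auto
    then have "real (2 * b * s + b) \<le> real (a * s)"
      using b s(1) by (simp add: algebra_simps)
    then have le: "2 * b * s + b \<le> a * s"
      by (simp only: of_nat_le_iff)
    \<comment> \<open>Otherwise \<open>a * s\<close> is at most \<open>2 * b * s\<close>,
      contradicting \<open>le\<close> because \<open>b\<close> is positive.\<close>
    have "2 * b \<le> a"
    proof (rule ccontr)
      assume "\<not> 2 * b \<le> a"
      then have "a * s \<le> 2 * b * s"
        by (intro mult_le_mono1) simp
      then show False
        using le b by linarith
    qed
    then obtain e where e: "a = 2 * b + e"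
      using le_Suc_ex by blast
    \<comment> \<open>Substituting \<open>a = 2 * b + e\<close> in \<open>le\<close> cancels
      \<open>2 * b * s\<close>. As \<open>s\<close> is at most both halves, the gain
      \<open>s * e\<close> is available on either cycle.\<close>
    have be: "b \<le> s * e"
      using le e by (simp add: algebra_simps)
    have "b \<le> (m div 2) * e" "b \<le> (n div 2) * e"
      using be s by (meson le_trans mult_le_mono1)+
    then show ?thesis
      unfolding e using assms by (intro free_choosable_BG) auto
  qed
  then show ?thesis
    using assms pair_graph_BG[of m n p] by (simp add: FCH_def floor)
qed

end
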